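(* Let $0<s<1$ and let $E$ be a subset of the Cantor dyadic group $G$. If there is a non-atomic mass distribution $\mu$ on $E$ which has finite $s$-energy, i.e. $I_s(\mu)<\infty$, then the Hausdorff dimension of $E$ (with respect to the metric $\rho$) satisfies $\dim_H(E)\ge s$.
   Context: The Cantor dyadic group $G$ is the set of all sequences $x=\{x_j\}_{j=1}^\infty$ with $x_j\in\{0,1\}$, with coordinate-wise addition modulo 2, topologized by the subgroups $G_n=\{x\in G: x_j=0,\ 1\le j\le n\}$ ($G_0=G$) as a base of neighborhoods of $0$. It is metrized by $\rho(x,y)=\sum_{i=1}^\infty 2^{-i}|x_i-y_i|$. For $n\ge 1$ let $K_n^2=G_{n-1}\setminus G_n$ (the coset of $G_n$ consisting of $x$ with $x_1=\dots=x_{n-1}=0$, $x_n=1$), so that $G\setminus\{0\}$ is the disjoint union of the sets $K_n^2$, $n\ge1$. The $s$-kernel is the function $\phi_s$ on $G$ given by $\phi_s(0)=0$ and $\phi_s(x)=2^{s(n-1)}$ if $x\in K_n^2$, $n\ge 1$. A mass distribution on a set $E\subset G$ is a nonzero finite positive Borel measure $\mu$ on $G$ supported on $E$ (that is, $G\setminus E$ is $\mu$-null). It is non-atomic if $\mu(\{x\})=0$ for every $x\in G$. The $s$-potential of $\mu$ is $\Phi_s(x)=\int_G\phi_s(x-y)\,d\mu(y)$ and its $s$-energy is $I_s(\mu)=\int_G\Phi_s(x)\,d\mu(x)\in[0,\infty]$. For $A\subset G$ and $\delta>0$, $H^s_\delta(A)=\inf\{\sum_{i=1}^\infty(\operatorname{diam}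 I_i)^s: A\subset\bigcup_{i=1}^\infty I_i,\ \operatorname{diam} I_i<\delta \text{ for all } i\}$ with diameters taken in $\rho$; $H^s(A)=\lim_{\delta\to0}H^s_\delta(A)$; and $\dim_H(A)=\inf\{s: H^s(A)=0\}$. *)

theory Defs
  imports "HOL-Analysis.Analysis" "HOL-Library.Z2"
begin

text \<open>Sequences are indexed from 0: \<open>coord x j\<close> is the mathematical coordinate \<open>x\<^sub>j\<^sub>+\<^sub>1\<close>.
  Addition of type \<open>bit\<close> is addition modulo 2.\<close>

typedef cantor = "UNIV :: (nat \<Rightarrow> bit) set"
  morphisms coord Cantor ..

lemma coord_Cantor [simp]: "coord (Cantor f) = f"
  by (simp add: Cantor_inverse)

lemma cantor_eqI: "(\<And>j. coord x j = coord y j) \<Longrightarrow> x = y"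
  by (metis coord_inject ext)

instantiation cantor :: ab_group_add
begin

definition zero_cantor :: cantor where "0 = Cantor (\<lambda>_. 0)"
definition plus_cantor :: "cantor \<Rightarrow> cantor \<Rightarrow> cantor"
  where "x + y = Cantor (\<lambda>j. coord x j + coord y j)"
definition uminus_cantor :: "cantor \<Rightarrow> cantor"
  where "- x = Cantor (\<lambda>j. - coord x j)"
definition minus_cantor :: "cantor \<Rightarrow> cantor \<Rightarrow> cantor"
  where "x - y = Cantor (\<lambda>j. coord x j - coord y j)"

instance
  by standard
    (auto intro!: cantor_eqI simp: zero_cantor_def plus_cantor_def uminus_cantor_def
      minus_cantor_def algebra_simps simp del: minus_bit_def uminus_bit_def)

end

lemma coord_zero [simp]: "coord 0 j = 0"
  by (simp add: zero_cantor_def)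

lemma coord_add [simp]: "coord (x + y) j = coord x j + coord y j"
  by (simp add: plus_cantor_def)

lemma coord_diff [simp]: "coord (x - y) j = coord x j - coord y j"
  by (simp add: minus_cantor_def)

lemma coord_diff_eq_0_iff: "coord (x - y) j = 0 \<longleftrightarrow> coord x j = coord y j"
  by (cases "coord x j"; cases "coord y j") auto

definition G :: "nat \<Rightarrow> cantor set"
  where "G n = {x. \<forall>j<n. coord x j = 0}"

lemma G_0: "G 0 = UNIV"
  by (simp add: G_def)

lemma mem_G_diff_iff: "y - x \<in> G n \<longleftrightarrow> (\<forall>j<n. coord x j = coord y j)"
  unfolding G_def mem_Collect_eq coord_diff_eq_0_iff by auto

text \<open>The metric is \<open>\<rho>\<close>; the topology is the one with the \<open>G n\<close> as base at 0. The instance proof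
  includes that the two agree.\<close>

instantiation cantor :: metric_space
begin

definition dist_cantor :: "cantor \<Rightarrow> cantor \<Rightarrow> real"
  where "dist x y = (\<Sum>i. (1/2) ^ Suc i * \<bar>of_bit (coord x i) - of_bit (coord y i)\<bar>)"

definition open_cantor :: "cantor set \<Rightarrow> bool"
  where "open U \<longleftrightarrow> (\<forall>x\<in>U. \<exists>n. \<forall>y. y - x \<in> G n \<longrightarrow> y \<in> U)"

definition uniformity_cantor :: "(cantor \<times> cantor) filter"
  where "uniformity = (INF e\<in>{0<..}. principal {(x::cantor, y). dist x y < e})"

lemma summable_dist_cantor:
  "summable (\<lambda>i. (1/2) ^ Suc i * \<bar>of_bit (coord x i) - of_bit (coord y i)\<bar> :: real)"
  by (rule summable_comparison_test'[OF sums_summable[OF power_half_series], of 0])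
    (auto simp: of_bool_def)

lemma dist_cantor_nonneg: "dist x (y::cantor) \<ge> 0"
  unfolding dist_cantor_def by (intro suminf_nonneg summable_dist_cantor) auto

lemma dist_cantor_ge:
  assumes "coord x i \<noteq> coord y i"
  shows "(1/2) ^ Suc i \<le> dist x y"
proof -
  have "(1/2) ^ Suc i = (\<Sum>k\<in>{i}. (1/2) ^ Suc k * \<bar>of_bit (coord x k) - of_bit (coord y k)\<bar> :: real)"
    using assms by (cases "coord x i"; cases "coord y i") auto
  also have "\<dots> \<le> dist x y"
    unfolding dist_cantor_def by (intro sum_le_suminf summable_dist_cantor) auto
  finally show ?thesis .
qed

lemma dist_cantor_le:
  assumes "y - x \<in> G n"
  shows "dist x y \<le> (1/2) ^ n"
proof -
  let ?f = "\<lambda>i. (1/2) ^ Suc i * \<bar>of_bit (coord x i) - of_bit (coord y i)\<bar> :: real"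
  have "dist x y = (\<Sum>i. ?f (i + n)) + (\<Sum>i<n. ?f i)"
    unfolding dist_cantor_def by (intro suminf_split_initial_segment summable_dist_cantor)
  also have "(\<Sum>i<n. ?f i) = 0"
    using assms by (auto simp: mem_G_diff_iff intro!: sum.neutral)
  also have "(\<Sum>i. ?f (i + n)) \<le> (\<Sum>i. (1/2) ^ n * (1/2) ^ Suc i)"
  proof (rule suminf_le)
    show "?f (i + n) \<le> (1/2) ^ n * (1/2) ^ Suc i" for i
      by (auto simp: of_bool_def power_add)
    show "summable (\<lambda>i. ?f (i + n))"
      using summable_ignore_initial_segment[OF summable_dist_cantor] .
    show "summable (\<lambda>i. (1/2) ^ n * (1/2) ^ Suc i :: real)"
      by (intro summable_mult sums_summable[OF power_half_series])
  qed
  also have "\<dots> = (1/2) ^ n"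
    using sums_unique[OF sums_mult[OF power_half_series, of "(1/2) ^ n"]] by simp
  finally show ?thesis by simp
qed

instance
proof
  show "uniformity = (INF e\<in>{0<..}. principal {(x::cantor, y). dist x y < e})"
    by (rule uniformity_cantor_def)
next
  fix x y :: cantor
  show "dist x y = 0 \<longleftrightarrow> x = y"
  proof
    assume 0: "dist x y = 0"
    show "x = y"
    proof (rule cantor_eqI, rule ccontr)
      fix j assume "coord x j \<noteq> coord y j"
      from dist_cantor_ge[OF this] 0 show False
        using zero_less_power[of "1/2::real" "Suc j"] by linarith
    qed
  qed (simp add: dist_cantor_def)
next
  fix x y z :: cantor
  let ?f = "\<lambda>x y i. (1/2) ^ Suc i * \<bar>of_bit (coord x i) - of_bit (coord y i)\<bar> :: real"
  have "dist x y \<le> (\<Sum>i. ?f x z i + ?f y z i)"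
    unfolding dist_cantor_def
  proof (intro suminf_le summable_add summable_dist_cantor)
    fix i
    have "\<bar>of_bit (coord x i) - of_bit (coord y i)\<bar> \<le>
        \<bar>of_bit (coord x i) - of_bit (coord z i)\<bar> + \<bar>of_bit (coord y i) - of_bit (coord z i) :: real\<bar>"
      by linarith
    from mult_left_mono[OF this, of "(1/2) ^ Suc i"]
    show "?f x y i \<le> ?f x z i + ?f y z i"
      by (simp only: distrib_left) simp
  qed
  also have "\<dots> = dist x z + dist y z"
    unfolding dist_cantor_def by (intro suminf_add[symmetric] summable_dist_cantor)
  finally show "dist x y \<le> dist x z + dist y z" .
next
  fix U :: "cantor set"
  have ev: "(\<forall>\<^sub>F (x', y) in uniformity. x' = x \<longrightarrow> y \<in> U) \<longleftrightarrow> (\<exists>e>0. \<forall>y. dist x y < e \<longrightarrow> y \<in> U)"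
    for x :: cantor
  proof -
    have "(\<forall>\<^sub>F (x', y) in uniformity. x' = x \<longrightarrow> y \<in> U) \<longleftrightarrow>
        (\<exists>e\<in>{0<..}. \<forall>\<^sub>F (x', y) in principal {(x, y). dist x y < e}. x' = x \<longrightarrow> y \<in> U)"
      unfolding uniformity_cantor_def
    proof (rule eventually_INF_base)
      fix a b :: real assume "a \<in> {0<..}" "b \<in> {0<..}"
      then show "\<exists>c\<in>{0<..}. principal {(x, y). dist x (y::cantor) < c}
          \<le> inf (principal {(x, y). dist x y < a}) (principal {(x, y). dist x y < b})"
        by (intro bexI[of _ "min a b"]) auto
    qed auto
    then show ?thesis by (auto simp: eventually_principal)
  qed
  have base: "(\<exists>n. \<forall>y. y - x \<in> G n \<longrightarrow> y \<in> U) \<longleftrightarrow> (\<exists>e>0. \<forall>y. dist x y < e \<longrightarrow> y \<in> U)"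
    for x :: cantor
  proof
    assume "\<exists>n. \<forall>y. y - x \<in> G n \<longrightarrow> y \<in> U"
    then obtain n where n: "\<And>y. y - x \<in> G n \<Longrightarrow> y \<in> U" by blast
    show "\<exists>e>0. \<forall>y. dist x y < e \<longrightarrow> y \<in> U"
    proof (intro exI[of _ "(1/2) ^ n"] conjI allI impI n)
      fix y assume *: "dist x y < (1/2) ^ n"
      show "y - x \<in> G n"
        unfolding mem_G_diff_iff
      proof (intro allI impI, rule ccontr)
        fix j assume "j < n" "coord x j \<noteq> coord y j"
        moreover have "(1/2 :: real) ^ n \<le> (1/2) ^ Suc j"
          using \<open>j < n\<close> by (intro power_decreasing) auto
        ultimately show False using dist_cantor_ge[of x j y] * by linarith
      qed
    qed auto
  next
    assume "\<exists>e>0. \<forall>y. dist x y < e \<longrightarrow> y \<in> U"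
    then obtain e where e: "e > 0" "\<And>y. dist x y < e \<Longrightarrow> y \<in> U" by blast
    obtain n where "(1/2 :: real) ^ n < e"
      using real_arch_pow_inv[OF e(1), of "1/2"] by auto
    then show "\<exists>n. \<forall>y. y - x \<in> G n \<longrightarrow> y \<in> U"
      by (meson dist_cantor_le e(2) le_less_trans)
  qed
  show "open U \<longleftrightarrow> (\<forall>x\<in>U. \<forall>\<^sub>F (x', y) in uniformity. x' = x \<longrightarrow> y \<in> U)"
    unfolding open_cantor_def ev base ..
qed

end

text \<open>Only used for \<open>n \<ge> 1\<close>.\<close>
definition K :: "nat \<Rightarrow> cantor set"
  where "K n = G (n - 1) - G n"

definition kernel :: "real \<Rightarrow> cantor \<Rightarrow> real"
  where "kernel s x =
    (if x = 0 then 0 else 2 powr (s * (real (THE n. n \<ge> 1 \<and> x \<in> K n) - 1)))"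

lemma mem_K_iff:
  assumes "n \<ge> 1"
  shows "x \<in> K n \<longleftrightarrow> (\<forall>j<n - 1. coord x j = 0) \<and> coord x (n - 1) = 1"
  using assms by (cases n) (auto simp: K_def G_def less_Suc_eq)

lemma K_unique:
  assumes "m \<ge> 1" "n \<ge> 1" "x \<in> K m" "x \<in> K n"
  shows "m = n"
proof -
  have "\<not> m - 1 < n - 1" "\<not> n - 1 < m - 1"
    using assms by (auto simp: mem_K_iff)
  with assms show ?thesis by linarith
qed

lemma UN_K: "(\<Union>n\<in>{1..}. K n) = - {0}"
proof (intro equalityI subsetI)
  fix x :: cantor assume "x \<in> - {0}"
  then have ex: "\<exists>j. coord x j \<noteq> 0" using cantor_eqI[of x 0] by (metis ComplD coord_zero singletonI)
  define k where "k = (LEAST j. coord x j \<noteq> 0)"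
  have "coord x k \<noteq> 0" "\<forall>j<k. coord x j = 0"
    using LeastI_ex[OF ex] not_less_Least[of _ "\<lambda>j. coord x j \<noteq> 0"] unfolding k_def by blast+
  then have "x \<in> K (Suc k)" by (subst mem_K_iff) auto
  then show "x \<in> (\<Union>n\<in>{1..}. K n)" by (intro UN_I[of "Suc k"]) auto
qed (auto simp: mem_K_iff)

lemma kernel_eq:
  assumes "n \<ge> 1" "x \<in> K n"
  shows "kernel s x = 2 powr (s * (real n - 1))"
proof -
  have "(THE m. m \<ge> 1 \<and> x \<in> K m) = n"
    using assms K_unique by (intro the_equality) auto
  moreover have "x \<noteq> 0" using assms UN_K by auto
  ultimately show ?thesis by (simp add: kernel_def)
qed

definition potential :: "real \<Rightarrow> cantor measure \<Rightarrow> cantor \<Rightarrow> ennreal"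
  where "potential s \<mu> x = (\<integral>\<^sup>+ y. ennreal (kernel s (x - y)) \<partial>\<mu>)"

definition energy :: "real \<Rightarrow> cantor measure \<Rightarrow> ennreal"
  where "energy s \<mu> = (\<integral>\<^sup>+ x. potential s \<mu> x \<partial>\<mu>)"

text \<open>\<open>E\<close> need not be Borel; \<open>AE\<close> says that the complement of \<open>E\<close> is contained in a Borel set
  of measure 0.\<close>
definition mass_distribution :: "cantor set \<Rightarrow> cantor measure \<Rightarrow> bool"
  where "mass_distribution E \<mu> \<longleftrightarrow>
    sets \<mu> = sets borel \<and> finite_measure \<mu> \<and> emeasure \<mu> UNIV \<noteq> 0 \<and> (AE x in \<mu>. x \<in> E)"

definition non_atomic :: "cantor measure \<Rightarrow> bool"
  where "non_atomic \<mu> \<longleftrightarrow> (\<forall>x. emeasure \<mu> {x} = 0)"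

definition hausdorff_premeasure :: "real \<Rightarrow> real \<Rightarrow> cantor set \<Rightarrow> ennreal"
  where "hausdorff_premeasure s \<delta> A =
    (INF I \<in> {I :: nat \<Rightarrow> cantor set. A \<subseteq> (\<Union>i. I i) \<and> (\<forall>i. diameter (I i) < \<delta>)}.
      \<Sum>i. ennreal (diameter (I i) powr s))"

definition hausdorff_measure :: "real \<Rightarrow> cantor set \<Rightarrow> ennreal"
  where "hausdorff_measure s A = Lim (at_right 0) (\<lambda>\<delta>. hausdorff_premeasure s \<delta> A)"

text \<open>The library function \<open>diameter\<close> is only meaningful on bounded sets; here every set is
  bounded.\<close>
lemma bounded_cantor: "bounded (S :: cantor set)"
  unfolding bounded_def using dist_cantor_le[where n = 0] by (auto simp: G_0)

lemma hausdorff_premeasure_antimono: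
  "\<delta> \<le> \<epsilon> \<Longrightarrow> hausdorff_premeasure s \<epsilon> A \<le> hausdorff_premeasure s \<delta> A"
  unfolding hausdorff_premeasure_def by (intro INF_superset_mono) (auto intro: less_le_trans)

lemma hausdorff_premeasure_tendsto_SUP:
  "((\<lambda>\<delta>. hausdorff_premeasure s \<delta> A) \<longlongrightarrow> (SUP \<delta>\<in>{0<..}. hausdorff_premeasure s \<delta> A)) (at_right 0)"
proof (rule order_tendstoI)
  fix a assume "a < (SUP \<delta>\<in>{0<..}. hausdorff_premeasure s \<delta> A)"
  then obtain d where "d > 0" "a < hausdorff_premeasure s d A" by (auto simp: less_SUP_iff)
  then show "\<forall>\<^sub>F \<delta> in at_right 0. a < hausdorff_premeasure s \<delta> A"
    using hausdorff_premeasure_antimono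
    by (intro eventually_at_rightI[of 0 d]) (auto intro: less_le_trans)
next
  fix a assume *: "(SUP \<delta>\<in>{0<..}. hausdorff_premeasure s \<delta> A) < a"
  show "\<forall>\<^sub>F \<delta> in at_right 0. hausdorff_premeasure s \<delta> A < a"
    by (intro eventually_at_rightI[of 0 1]) (auto intro: le_less_trans[OF SUP_upper *])
qed

lemma hausdorff_measure_eq_SUP:
  "hausdorff_measure s A = (SUP \<delta>\<in>{0<..}. hausdorff_premeasure s \<delta> A)"
  unfolding hausdorff_measure_def
  by (intro tendsto_Lim hausdorff_premeasure_tendsto_SUP) simp

text \<open>The exponent ranges over \<open>t > 0\<close>, so the convention for \<open>0 powr 0\<close> is irrelevant. Admitting
  \<open>t = 0\<close> would not change the infimum: if the measure of exponent 0 vanishes, so do those of all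
  exponents \<open>t > 0\<close>.\<close>
definition hausdorff_dim :: "cantor set \<Rightarrow> ereal"
  where "hausdorff_dim A = Inf {ereal t | t. t > 0 \<and> hausdorff_measure t A = 0}"

end

theory Submission
  imports Defs
begin

text \<open>Since \<open>\<mu>\<close> has no atoms, the potential at \<open>x\<close> dominates \<open>2\<^sup>s\<^sup>n \<mu>(x + G\<^sub>n)\<close> for every \<open>n\<close>.
  The supremum of these locally constant functions of \<open>x\<close> thus has finite integral, so it is bounded
  by some \<open>N\<close> on a set \<open>A\<close> of positive measure. A set of diameter \<open>d < 1\<close> that meets \<open>A\<close> lies in
  a coset \<open>x + G\<^sub>n\<close> with \<open>x \<in> A\<close> and \<open>2\<^sup>-\<^sup>n \<le> 2d\<close>, of measure at most \<open>N (2d)\<^sup>s\<close>. Summing over a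
  cover of \<open>E\<close> bounds the sums of \<open>d\<^sup>t\<close> away from 0 for every \<open>t \<le> s\<close>.\<close>

text \<open>The coset of \<open>G n\<close> through \<open>x\<close>, written with a difference
  because \<open>open_cantor\<close> is phrased that way.\<close>

definition cyl :: "nat \<Rightarrow> cantor \<Rightarrow> cantor set"
  where "cyl n x = {y. y - x \<in> G n}"

lemma mem_cyl_iff: "y \<in> cyl n x \<longleftrightarrow> (\<forall>j<n. coord x j = coord y j)"
  by (simp add: cyl_def mem_G_diff_iff)

lemma cyl_self: "x \<in> cyl n x"
  by (simp add: mem_cyl_iff)

lemma cyl_eq: "y \<in> cyl n x \<Longrightarrow> cyl n y = cyl n x"
  by (auto simp: mem_cyl_iff)

text \<open>A function that factors through \<open>cyl n\<close> is constant on each coset of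
  \<open>G n\<close>, so the preimage of an arbitrary set, even a non-measurable one, is open. This
  gives openness of cylinders and measurability of their masses as functions of the centre.\<close>

lemma open_vimage_cyl: "open ((\<lambda>x. f (cyl n x)) -` S)"
  unfolding open_cantor_def
proof
  fix x assume "x \<in> (\<lambda>x. f (cyl n x)) -` S"
  then show "\<exists>m. \<forall>y. y - x \<in> G m \<longrightarrow> y \<in> (\<lambda>x. f (cyl n x)) -` S"
    using cyl_eq[of _ n x] by (intro exI[of _ n]) (metis cyl_def mem_Collect_eq vimageE vimageI)
qed

lemma open_cyl: "open (cyl n x)"
proof -
  have "cyl n x = (\<lambda>z. cyl n z) -` {cyl n x}"
    by (blast dest: cyl_eq intro: cyl_self)
  then show ?thesis using open_vimage_cyl[of "\<lambda>C. C" n "{cyl n x}"] by simp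
qed

lemma dist_less_mem_cyl:
  assumes "dist x y < (1/2) ^ n"
  shows "y \<in> cyl n x"
  unfolding mem_cyl_iff
proof (intro allI impI, rule ccontr)
  fix j assume "j < n" "coord x j \<noteq> coord y j"
  moreover have "(1/2 :: real) ^ n \<le> (1/2) ^ Suc j"
    using \<open>j < n\<close> by (intro power_decreasing) auto
  ultimately show False using dist_cantor_ge[of x j y] assms by linarith
qed

text \<open>Agreement in the first \<open>n\<close> coordinates pushes the first nonzero coordinate
  of \<open>x - y\<close> to index \<open>n\<close> or later. The point \<open>y = x\<close> is
  excluded because the kernel vanishes at 0.\<close>

lemma kernel_ge:
  assumes "0 \<le> s" "y \<in> cyl n x" "y \<noteq> x"
  shows "2 powr (s * real n) \<le> kernel s (x - y)"
proof -
  have "x - y \<in> - {0}" using assms by simp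
  then obtain m where m: "m \<ge> 1" "x - y \<in> K m" unfolding UN_K[symmetric] by auto
  have "n \<le> m - 1"
  proof (rule ccontr)
    assume "\<not> n \<le> m - 1"
    then have "coord (x - y) (m - 1) = 0"
      using assms(2) by (simp add: mem_cyl_iff coord_diff_eq_0_iff del: coord_diff)
    then show False using m by (simp add: mem_K_iff del: coord_diff)
  qed
  then have "real n \<le> real m - 1" using m(1) by linarith
  then have "s * real n \<le> s * (real m - 1)" using assms(1) by (rule mult_left_mono)
  then show ?thesis unfolding kernel_eq[OF m] by (rule powr_mono) simp
qed

lemma potential_ge:
  assumes "0 \<le> s" "sets \<mu> = sets borel" "non_atomic \<mu>"
  shows "ennreal (2 powr (s * real n)) * emeasure \<mu> (cyl n x) \<le> potential s \<mu> x"
proof -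
  have [measurable]: "cyl n x - {x} \<in> sets \<mu>" "cyl n x \<in> sets \<mu>" "{x} \<in> sets \<mu>"
    using assms(2) open_cyl by auto
  have "{x} \<in> null_sets \<mu>"
    using assms(3) by (auto simp: non_atomic_def)
  \<comment> \<open>Non-atomicity enters here: removing the centre, where the kernel gives no lower
    bound, costs no mass.\<close>
  then have "emeasure \<mu> (cyl n x) = emeasure \<mu> (cyl n x - {x})"
    by (simp add: emeasure_Diff_null_set)
  then have "ennreal (2 powr (s * real n)) * emeasure \<mu> (cyl n x)
      = (\<integral>\<^sup>+ y. ennreal (2 powr (s * real n)) * indicator (cyl n x - {x}) y \<partial>\<mu>)"
    by (simp add: nn_integral_cmult_indicator)
  also have "\<dots> \<le> potential s \<mu> x"
    unfolding potential_def
    using kernel_ge[OF assms(1), of _ n x]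
    by (intro nn_integral_mono) (auto simp: indicator_def intro!: ennreal_leI)
  finally show ?thesis .
qed

text \<open>The supremum of the scaled cylinder masses lies below the potential, so its integral is
  finite and it is finite almost everywhere. Countably many sublevel sets then cover almost all of
  the space, and one of them has positive mass.\<close>

lemma finite_energy_imp_bounded_density:
  assumes "0 \<le> s" and sets: "sets \<mu> = sets borel" and "emeasure \<mu> UNIV \<noteq> 0"
    and "non_atomic \<mu>" and "energy s \<mu> < \<infinity>"
  obtains N :: nat and A where "N > 0" "A \<in> sets \<mu>" "emeasure \<mu> A > 0"
    "\<forall>x\<in>A. \<forall>n. ennreal (2 powr (s * real n)) * emeasure \<mu> (cyl n x) \<le> of_nat N"
proof -
  define g where "g x = (SUP n. ennreal (2 powr (s * real n)) * emeasure \<mu> (cyl n x))" for x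
  have space: "space \<mu> = UNIV" using sets_eq_imp_space_eq[OF sets] by simp
  have [measurable]: "g \<in> borel_measurable \<mu>"
    unfolding g_def
  proof (intro borel_measurable_SUP borel_measurableI)
    fix n and S :: "ennreal set"
    show "(\<lambda>x. ennreal (2 powr (s * real n)) * emeasure \<mu> (cyl n x)) -` S \<inter> space \<mu> \<in> sets \<mu>"
      using open_vimage_cyl[of "\<lambda>C. ennreal (2 powr (s * real n)) * emeasure \<mu> C" n S]
      by (simp add: sets space)
  qed auto
  have "(\<integral>\<^sup>+ x. g x \<partial>\<mu>) \<le> energy s \<mu>"
    unfolding energy_def g_def
    by (intro nn_integral_mono SUP_least potential_ge assms)
  then have fin: "AE x in \<mu>. g x \<noteq> \<infinity>"
    using assms(5) by (intro nn_integral_PInf_AE) auto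
  \<comment> \<open>\<open>Suc N\<close> keeps the bound positive, as needed when dividing by the
    constant built from it.\<close>
  define A where "A N = {x \<in> space \<mu>. g x \<le> of_nat (Suc N)}" for N :: nat
  have A [measurable]: "A N \<in> sets \<mu>" for N unfolding A_def by measurable
  have "\<exists>N. emeasure \<mu> (A N) \<noteq> 0"
  proof (rule ccontr)
    assume "\<nexists>N. emeasure \<mu> (A N) \<noteq> 0"
    then have "A N \<in> null_sets \<mu>" for N using A by auto
    then have "AE x in \<mu>. \<forall>N. x \<notin> A N"
      by (simp add: AE_all_countable AE_not_in)
    with fin have "AE x in \<mu>. x \<notin> space \<mu>"
    proof eventually_elim
      case (elim x)
      then obtain N :: nat where "g x < of_nat N"
        using ennreal_Ex_less_of_nat[of "g x"] by (auto simp: top.not_eq_extremum)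
      moreover have "of_nat N \<le> (of_nat (Suc N) :: ennreal)"
        by (rule of_nat_mono) simp
      ultimately have "g x \<le> of_nat (Suc N)"
        by order
      with elim show ?case unfolding A_def space by blast
    qed
    then have "space \<mu> \<in> null_sets \<mu>"
      by (subst AE_iff_null_sets) auto
    with assms(3) space show False by auto
  qed
  then obtain N where N: "emeasure \<mu> (A N) > 0" by (auto simp: zero_less_iff_neq_zero)
  show thesis
  proof (rule that[OF zero_less_Suc A N], intro ballI allI)
    fix x n assume "x \<in> A N"
    then have "g x \<le> of_nat (Suc N)" unfolding A_def by blast
    then show "ennreal (2 powr (s * real n)) * emeasure \<mu> (cyl n x) \<le> of_nat (Suc N)"
      unfolding g_def SUP_le_iff by blast
  qed
qed

text \<open>Since \<open>I\<close> may fail to be Borel, the estimate is stated for a measurable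
  \<open>C\<close> around \<open>A \<inter> I\<close>: the empty set, a singleton or a cylinder
  centred in \<open>A\<close>.\<close>

lemma frostman_diameter:
  assumes "0 \<le> s" and sets: "sets \<mu> = sets borel" and "non_atomic \<mu>"
    and dens: "\<And>x n. x \<in> A \<Longrightarrow> ennreal (2 powr (s * real n)) * emeasure \<mu> (cyl n x) \<le> of_nat N"
    and "diameter I < 1"
  shows "\<exists>C\<in>sets \<mu>. A \<inter> I \<subseteq> C \<and>
    emeasure \<mu> C \<le> ennreal (real N * 2 powr s) * ennreal (diameter I powr s)"
proof (cases "A \<inter> I = {}")
  case True
  then show ?thesis by (intro bexI[of _ "{}"]) auto
next
  case False
  then obtain x where x: "x \<in> A" "x \<in> I" by auto
  define d where "d = diameter I"
  have le: "dist x y \<le> d" if "y \<in> I" for y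
    unfolding d_def using diameter_bounded_bound[OF bounded_cantor x(2) that] .
  have "d \<ge> 0" unfolding d_def by (intro diameter_ge_0 bounded_cantor)
  show ?thesis
  proof (cases "d = 0")
    case True
    \<comment> \<open>The bound to be met is 0, since \<open>0 powr s = 0\<close>; a singleton meets
      it because there are no atoms.\<close>
    then have "I \<subseteq> {x}" using le by fastforce
    then show ?thesis using sets assms(3)
      by (intro bexI[of _ "{x}"]) (auto simp: non_atomic_def)
  next
    case False
    with \<open>d \<ge> 0\<close> have "d > 0" by simp
    then obtain k where k: "(1/2) ^ k \<le> d"
      using real_arch_pow_inv[of d "1/2"] by (auto intro: less_imp_le)
    \<comment> \<open>The least such \<open>m\<close> is positive because \<open>d < 1\<close>; its
      predecessor \<open>n\<close> satisfies \<open>d < (1/2) ^ n \<le> 2 * d\<close>. The upper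
      bound is the source of the factor \<open>2 powr s\<close>.\<close>
    define m where "m = (LEAST k. (1/2) ^ k \<le> d)"
    have m: "(1/2) ^ m \<le> d" unfolding m_def using k by (rule LeastI)
    with assms(5) have "m \<noteq> 0" by (cases m) (auto simp: d_def)
    then obtain n where n: "m = Suc n" by (cases m) auto
    then have "\<not> (1/2) ^ n \<le> d" using not_less_Least[of n "\<lambda>k. (1/2) ^ k \<le> d"] m_def by simp
    then have I: "I \<subseteq> cyl n x" using le by (force intro: dist_less_mem_cyl)
    have "emeasure \<mu> (cyl n x)
        = ennreal (2 powr (- (s * real n))) * (ennreal (2 powr (s * real n)) * emeasure \<mu> (cyl n x))"
      by (simp add: mult.assoc[symmetric] ennreal_mult[symmetric] powr_add[symmetric])
    also have "\<dots> \<le> ennreal (2 powr (- (s * real n))) * of_nat N"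
      by (intro mult_left_mono dens x) auto
    also have "\<dots> = ennreal (2 powr (- (s * real n)) * real N)"
      by (simp add: ennreal_mult ennreal_of_nat_eq_real_of_nat)
    also have "\<dots> \<le> ennreal (real N * 2 powr s * d powr s)"
    proof (rule ennreal_leI)
      have "2 powr (- (s * real n)) = ((1/2) ^ n) powr s"
        by (simp add: powr_realpow[symmetric] powr_powr powr_minus powr_divide mult.commute
            inverse_eq_divide)
      also have "\<dots> \<le> (2 * d) powr s"
        using m n assms(1) by (intro powr_mono2) auto
      also have "\<dots> = 2 powr s * d powr s" using \<open>d > 0\<close> by (simp add: powr_mult)
      finally have "real N * 2 powr (- (s * real n)) \<le> real N * (2 powr s * d powr s)"
        by (rule mult_left_mono) simp
      then show "2 powr (- (s * real n)) * real N \<le> real N * 2 powr s * d powr s"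
        by (simp only: mult.assoc mult.commute[of _ "real N"])
    qed
    finally show ?thesis using I sets open_cyl
      by (intro bexI[of _ "cyl n x"]) (auto simp: d_def ennreal_mult)
  qed
qed

text \<open>Countable subadditivity over any cover of \<open>E\<close> by sets of diameter below 1
  bounds the mass of \<open>A\<close> by a constant times the sum of the powers of the
  diameters.\<close>

lemma mass_distribution_principle:
  assumes "0 \<le> s" "t \<le> s" and sets: "sets \<mu> = sets borel" and "non_atomic \<mu>"
    and E: "AE x in \<mu>. x \<in> E" and A: "A \<in> sets \<mu>"
    and dens: "\<And>x n. x \<in> A \<Longrightarrow> ennreal (2 powr (s * real n)) * emeasure \<mu> (cyl n x) \<le> of_nat N"
    and "N > 0"
  shows "emeasure \<mu> A \<le> ennreal (real N * 2 powr s) * hausdorff_measure t E"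
proof -
  let ?c = "ennreal (real N * 2 powr s)"
  have cover: "emeasure \<mu> A \<le> ?c * (\<Sum>i. ennreal (diameter (I i) powr t))"
    if I: "E \<subseteq> (\<Union>i. I i)" "\<And>i. diameter (I i) < 1" for I :: "nat \<Rightarrow> cantor set"
  proof -
    have "\<forall>i. \<exists>C\<in>sets \<mu>. A \<inter> I i \<subseteq> C \<and> emeasure \<mu> C \<le> ?c * ennreal (diameter (I i) powr s)"
      using frostman_diameter[OF assms(1) sets assms(4) dens I(2)] by blast
    then obtain C where C: "\<And>i. C i \<in> sets \<mu>" "\<And>i. A \<inter> I i \<subseteq> C i"
      "\<And>i. emeasure \<mu> (C i) \<le> ?c * ennreal (diameter (I i) powr s)" by metis
    have "emeasure \<mu> A \<le> emeasure \<mu> (\<Union>i. C i)"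
    proof (rule emeasure_mono_AE)
      show "AE x in \<mu>. x \<in> A \<longrightarrow> x \<in> (\<Union>i. C i)"
        using E
      proof eventually_elim
        case (elim x)
        then obtain i where "x \<in> I i" using I(1) by auto
        then show ?case using C(2)[of i] by auto
      qed
    qed (use C(1) in auto)
    also have "\<dots> \<le> (\<Sum>i. emeasure \<mu> (C i))"
      using C(1) by (intro emeasure_subadditive_countably) auto
    also have "\<dots> \<le> (\<Sum>i. ?c * ennreal (diameter (I i) powr t))"
    proof (intro suminf_le)
      fix i
      \<comment> \<open>For bases in the unit interval, lowering the exponent from \<open>s\<close>
        to \<open>t\<close> can only increase the power.\<close>
      have "diameter (I i) powr s \<le> diameter (I i) powr t"
        using assms(2) I(2)[of i] diameter_ge_0[OF bounded_cantor, of "I i"]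
        by (intro powr_mono') auto
      then show "emeasure \<mu> (C i) \<le> ?c * ennreal (diameter (I i) powr t)"
        using C(3)[of i] by (meson ennreal_leI mult_left_mono order_trans zero_le)
    qed auto
    finally show ?thesis by simp
  qed
  \<comment> \<open>A positive finite constant can be divided out in \<open>ennreal\<close>, moved
    past the infimum and multiplied back.\<close>
  have c: "?c > 0" "?c < \<infinity>" using assms(8) by (auto simp: ennreal_zero_less_mult_iff)
  have "emeasure \<mu> A / ?c \<le> hausdorff_premeasure t 1 E"
    unfolding hausdorff_premeasure_def
    by (intro INF_greatest divide_le_posI_ennreal c cover) auto
  then have "?c * (emeasure \<mu> A / ?c) \<le> ?c * hausdorff_premeasure t 1 E"
    by (rule mult_left_mono) simp
  moreover have "?c * (emeasure \<mu> A / ?c) = emeasure \<mu> A"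
  proof -
    have "?c / ?c = 1" using assms(8) by (intro ennreal_divide_self) auto
    then show ?thesis
      using ennreal_divide_times[of "emeasure \<mu> A" ?c ?c] by (metis mult.commute mult_1_right)
  qed
  ultimately have "emeasure \<mu> A \<le> ?c * hausdorff_premeasure t 1 E"
    by simp
  \<comment> \<open>The single scale 1 suffices, since the Hausdorff measure is the supremum of the
    premeasures.\<close>
  also have "\<dots> \<le> ?c * hausdorff_measure t E"
    unfolding hausdorff_measure_eq_SUP by (intro mult_left_mono SUP_upper) auto
  finally show ?thesis .
qed

theorem theorem1:
  fixes s :: real and E :: "cantor set"
  assumes "0 < s" and "s < 1"
    and "\<exists>\<mu>. mass_distribution E \<mu> \<and> non_atomic \<mu> \<and> energy s \<mu> < \<infinity>"
  shows "ereal s \<le> hausdorff_dim E"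
  unfolding hausdorff_dim_def
proof (rule Inf_greatest, clarsimp, rule ccontr)
  fix t :: real assume t: "0 < t" "hausdorff_measure t E = 0" "\<not> s \<le> t"
  from assms(3) obtain \<mu> where \<mu>: "sets \<mu> = sets borel" "emeasure \<mu> UNIV \<noteq> 0"
    "AE x in \<mu>. x \<in> E" "non_atomic \<mu>" "energy s \<mu> < \<infinity>"
    unfolding mass_distribution_def by blast
  from finite_energy_imp_bounded_density[OF less_imp_le[OF assms(1)] \<mu>(1,2,4,5)]
  obtain N :: nat and A where A: "N > 0" "A \<in> sets \<mu>" "emeasure \<mu> A > 0"
    "\<forall>x\<in>A. \<forall>n. ennreal (2 powr (s * real n)) * emeasure \<mu> (cyl n x) \<le> of_nat N"
    by blast
  \<comment> \<open>With \<open>t < s\<close> and vanishing measure of exponent \<open>t\<close>,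
    the right side is 0, against the positive mass of \<open>A\<close>.\<close>
  have "emeasure \<mu> A \<le> ennreal (real N * 2 powr s) * hausdorff_measure t E"
    using assms(1) t(3) \<mu> A by (intro mass_distribution_principle) auto
  with t(2) A(3) show False by simp
qed

end
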